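(* Let $(\Phi,\Delta)$ be a weakly hyperbolic based root system in a Lorentzian $(n+1)$-space $(V,B)$, with associated Coxeter group $W\subseteq \mathrm{O}_B(V)$, and fix a basis $(e_1,\dots,e_{n+1})$ of $V$ and the affine hyperplane $\mathcal H=\{x_{n+1}=1\}$ as described in the context. Then the limit set $\Lambda(W)$ of $W$, acting on the projective model $\mathbb H^n_p=Q^-\cap\mathcal H$, is equal to the set $E(\Phi)$ of limit roots of $\Phi$.
   Context: $V$ is a real vector space of dimension $n+1$ with a symmetric bilinear form $B$ of signature $(n,1)$ (a Lorentzian space); $q(v)=B(v,v)$, $Q=\{v: q(v)=0\}$, $Q^-=\{v:q(v)<0\}$. For $\alpha$ with $B(\alpha,\alpha)=1$, the $B$-reflection is $s_\alpha(v)=v-2B(\alpha,v)\alpha$. A simple system is a finite subset $\Delta\subset V$ such that: (i) $\Delta$ is positively independent (if $\sum_{\alpha\in\Delta}\lambda_\alpha\alpha=0$ with all $\lambda_\alpha\ge0$ then all $\lambda_\alpha=0$); (ii) for $\alpha\ne\beta$ in $\Delta$, $B(\alpha,\beta)\in\,]-\infty,-1]\cup\{-\cos(\pi/k):k\in\mathbb Z_{\ge2}\}$; (iii) $B(\alpha,\alpha)=1$ for all $\alpha\in\Delta$. $W$ is the subgroup of $\mathrm{O}_B(V)$ generated by $S=\{s_\alpha:\alpha\in\Delta\}$, $\Phi=W(\Delta)$ is the root system, $\Phi^+=\Phi\cap\operatorname{cone}(\Delta)$ the positive roots. The root system is weakly hyperbolic if $\operatorname{span}(\Delta)=V$. Fix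 a basis $(e_1,\dots,e_{n+1})$ of $V$ in which $q(v)=x_1^2+\dots+x_n^2-x_{n+1}^2$, such that the affine hyperplane $\mathcal H=\{x_{n+1}=1\}$ meets every line $\mathbb R\beta$, $\beta\in\Phi^+$ (transverse to $\Phi^+$), and $B(e_{n+1},\alpha)<0$ for all $\alpha\in\Delta$ (such a basis exists). For $v$ not in the linear hyperplane directing $\mathcal H$, $\widehat v$ denotes the intersection point of $\mathbb Rv$ with $\mathcal H$. The set of limit roots $E(\Phi)$ is the set of accumulation points of $\widehat\Phi=\{\widehat\beta:\beta\in\Phi\}$. The projective model $\mathbb H^n_p$ of hyperbolic $n$-space is the open unit ball $Q^-\cap\mathcal H$ (isometric via $v\mapsto v/\sqrt{|q(v)|}$ to the hyperboloid $\{q=-1,x_{n+1}>0\}$), with boundary $Q\cap\mathcal H$; $W$ acts on it by $w\cdot x=\widehat{w(x)}$, as a discrete group of hyperbolic isometries. The limit set $\Lambda(W)$ is the set of accumulation points of the orbit $W\cdot x_0$ for any $x_0\in\mathbb H^n_p$ (independent of $x_0$); it lies in $Q\cap\mathcal H$. *)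

theory Defs
  imports "HOL-Analysis.Analysis"
begin

text \<open>Conventions. The Lorentzian space V of dimension n+1 is realised as
  'a \<times> real, with 'a a Euclidean space of dimension n (coordinates x_1..x_n) and
  the second component the coordinate x_(n+1) in the fixed basis (e_1,...,e_(n+1)).
  In this basis q(v) = x_1^2+...+x_n^2 - x_(n+1)^2, so B is the standard Minkowski form.\<close>

definition lorB :: "('a::euclidean_space \<times> real) \<Rightarrow> ('a \<times> real) \<Rightarrow> real" where
  "lorB u v = fst u \<bullet> fst v - snd u * snd v"

definition lorq :: "('a::euclidean_space \<times> real) \<Rightarrow> real" where
  "lorq v = lorB v v"

definition e_last :: "'a::euclidean_space \<times> real" where
  "e_last = (0, 1)"

definition lor_refl :: "('a::euclidean_space \<times> real) \<Rightarrow> ('a \<times> real) \<Rightarrow> ('a \<times> real)" where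
  "lor_refl \<alpha> v = v - (2 * lorB \<alpha> v) *\<^sub>R \<alpha>"

definition positively_independent :: "('a::euclidean_space \<times> real) set \<Rightarrow> bool" where
  "positively_independent D \<longleftrightarrow>
     (\<forall>c. (\<forall>\<alpha>\<in>D. c \<alpha> \<ge> 0) \<and> (\<Sum>\<alpha>\<in>D. c \<alpha> *\<^sub>R \<alpha>) = 0 \<longrightarrow> (\<forall>\<alpha>\<in>D. c \<alpha> = 0))"

definition simple_system :: "('a::euclidean_space \<times> real) set \<Rightarrow> bool" where
  "simple_system D \<longleftrightarrow> finite D \<and> positively_independent D
     \<and> (\<forall>\<alpha>\<in>D. \<forall>\<beta>\<in>D. \<alpha> \<noteq> \<beta> \<longrightarrow>
           lorB \<alpha> \<beta> \<le> -1 \<or> (\<exists>k::nat. k \<ge> 2 \<and> lorB \<alpha> \<beta> = - cos (pi / real k)))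
     \<and> (\<forall>\<alpha>\<in>D. lorB \<alpha> \<alpha> = 1)"

text \<open>The group W generated by the reflections s_\<alpha>, \<alpha> \<in> D (the reflections are
  involutions, so the monoid they generate is the group they generate).\<close>
inductive_set coxeter_group :: "('a::euclidean_space \<times> real) set \<Rightarrow> (('a \<times> real) \<Rightarrow> ('a \<times> real)) set"
  for D where
  id_in: "id \<in> coxeter_group D"
| refl_comp: "\<alpha> \<in> D \<Longrightarrow> w \<in> coxeter_group D \<Longrightarrow> lor_refl \<alpha> \<circ> w \<in> coxeter_group D"

definition root_system :: "('a::euclidean_space \<times> real) set \<Rightarrow> ('a \<times> real) set" where
  "root_system D = {w \<alpha> | w \<alpha>. w \<in> coxeter_group D \<and> \<alpha> \<in> D}"

definition pos_cone :: "('a::euclidean_space \<times> real) set \<Rightarrow> ('a \<times> real) set" where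
  "pos_cone D = {\<Sum>\<alpha>\<in>D. c \<alpha> *\<^sub>R \<alpha> | c. \<forall>\<alpha>\<in>D. c \<alpha> \<ge> 0}"

definition positive_roots :: "('a::euclidean_space \<times> real) set \<Rightarrow> ('a \<times> real) set" where
  "positive_roots D = root_system D \<inter> pos_cone D"

text \<open>Intersection of the line through v with the affine hyperplane H = {x_(n+1) = 1}.\<close>
definition hat :: "('a::euclidean_space \<times> real) \<Rightarrow> ('a \<times> real)" where
  "hat v = (1 / snd v) *\<^sub>R v"

definition H_aff :: "('a::euclidean_space \<times> real) set" where
  "H_aff = {v. snd v = 1}"

definition proj_model :: "('a::euclidean_space \<times> real) set" where
  "proj_model = {v. lorq v < 0} \<inter> H_aff"

definition limit_roots :: "('a::euclidean_space \<times> real) set \<Rightarrow> ('a \<times> real) set" where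
  "limit_roots D = {x. x islimpt {hat \<beta> | \<beta>. \<beta> \<in> root_system D \<and> snd \<beta> \<noteq> 0}}"

definition orbit_limit_points :: "('a::euclidean_space \<times> real) set \<Rightarrow> ('a \<times> real) \<Rightarrow> ('a \<times> real) set" where
  "orbit_limit_points D x0 = {x. x islimpt {hat (w x0) | w. w \<in> coxeter_group D}}"

end

theory Submission
  imports Defs
begin

text \<open>The base point \<open>e_last\<close> lies in the open fundamental chamber.  By Tits' lemma (an element
  whose length is not decreased by the simple reflection of \<open>\<alpha>\<close> maps \<open>\<alpha>\<close> to a positive root)
  every nontrivial \<open>w\<close> moves the base point by a definite amount, so the orbit is uniformly
  discrete.  Limit points are compared by the identity
  \<open>|hat u - hat v|^2 = q(u)/s(u)^2 + q(v)/s(v)^2 - 2 B(u,v)/(s(u) s(v))\<close>, with \<open>s\<close> the last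
  coordinate: vectors of bounded norm \<open>q\<close> whose last coordinates tend to infinity while their
  products \<open>B\<close> stay comparatively small have the same limit directions.  It is applied to the
  orbits of two points, to \<open>w e_last\<close> and \<open>w \<alpha>\<close>, and to \<open>\<beta>\<close> and the reflection of \<open>e_last\<close> along
  \<open>\<beta>\<close>.\<close>

section \<open>The Minkowski form and its reflections\<close>

lemma lorB_commute: "lorB u v = lorB v u"
  by (simp add: lorB_def inner_commute)

lemma lorB_simps [simp]:
  "lorB (u + v) x = lorB u x + lorB v x"
  "lorB x (u + v) = lorB x u + lorB x v"
  "lorB (u - v) x = lorB u x - lorB v x"
  "lorB x (u - v) = lorB x u - lorB x v"
  "lorB (c *\<^sub>R u) x = c * lorB u x"
  "lorB x (c *\<^sub>R u) = c * lorB x u"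
  "lorB (- u) x = - lorB u x"
  "lorB x (- u) = - lorB x u"
  by (simp_all add: lorB_def algebra_simps)

lemma linear_lorB: "linear (lorB x)"
  by (rule linearI) simp_all

lemma lorB_e_last: "lorB e_last v = - snd v"
  by (simp add: lorB_def e_last_def)

lemma lorq_e_last: "lorq e_last = -1"
  by (simp add: lorq_def lorB_def e_last_def)

lemma lorq_eq: "lorq v = (norm (fst v))\<^sup>2 - (snd v)\<^sup>2"
  by (simp add: lorq_def lorB_def power2_norm_eq_inner power2_eq_square[of "snd v"])

lemma snd_e_last [simp]: "snd e_last = 1"
  by (simp add: e_last_def)

lemma norm_fst_le_snd:
  assumes "lorq v \<le> 0" "snd v \<ge> 0"
  shows "norm (fst v) \<le> snd v"
  using assms power2_le_imp_le[of "norm (fst v)" "snd v"] by (simp only: lorq_eq)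

lemma lorq_le_norm: "lorq v \<le> (norm v)\<^sup>2"
  by (simp add: lorq_eq norm_prod_def)

text \<open>By Cauchy-Schwarz, timelike vectors on opposite sides of the light cone have nonnegative
  product; a negative product therefore forces the same time orientation.\<close>

lemma lorB_neg_imp_snd_pos:
  assumes v: "lorq v < 0" "snd v > 0" and u: "lorq u < 0" "lorB u v < 0"
  shows "snd u > 0"
proof (rule ccontr)
  assume n: "\<not> snd u > 0"
  have 1: "norm (fst v) < snd v"
    by (rule power2_less_imp_less) (use v in \<open>simp_all add: lorq_eq\<close>)
  have "norm (fst u) < \<bar>snd u\<bar>"
    by (rule power2_less_imp_less) (use u(1) in \<open>simp_all add: lorq_eq\<close>)
  then have "norm (fst u) * norm (fst v) \<le> - snd u * snd v"
    using 1 n by (intro mult_mono) simp_all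
  moreover have "\<bar>fst u \<bullet> fst v\<bar> \<le> norm (fst u) * norm (fst v)"
    by (rule Cauchy_Schwarz_ineq2)
  ultimately show False
    using u(2) by (simp add: lorB_def)
qed

lemma linear_lor_refl: "linear (lor_refl \<alpha>)"
  by (rule linearI) (simp_all add: lor_refl_def algebra_simps)

lemma lor_refl_self: "lorB \<alpha> \<alpha> = 1 \<Longrightarrow> lor_refl \<alpha> \<alpha> = - \<alpha>"
  by (simp add: lor_refl_def scaleR_2)

lemma lor_refl_invol: "lorB \<alpha> \<alpha> = 1 \<Longrightarrow> lor_refl \<alpha> (lor_refl \<alpha> v) = v"
  by (simp add: lor_refl_def algebra_simps)

lemma lor_refl_comp_self: "lorB \<alpha> \<alpha> = 1 \<Longrightarrow> lor_refl \<alpha> \<circ> lor_refl \<alpha> = id"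
  by (auto simp: lor_refl_invol)

lemma lorB_lor_refl: "lorB \<alpha> \<alpha> = 1 \<Longrightarrow> lorB (lor_refl \<alpha> u) (lor_refl \<alpha> v) = lorB u v"
  by (simp add: lor_refl_def algebra_simps lorB_commute)

lemma lor_refl_orthogonal: "lorB \<alpha> v = 0 \<Longrightarrow> lor_refl \<alpha> v = v"
  by (simp add: lor_refl_def)

text \<open>The product of \<open>v\<close> with its mirror image is
  \<open>lorq v - 2 * (lorB \<alpha> v)\<^sup>2\<close>, which is negative, so both have the same
  time orientation.\<close>

lemma lor_refl_future:
  assumes "lorB \<alpha> \<alpha> = 1" "lorq v < 0" "snd v > 0"
  shows "snd (lor_refl \<alpha> v) > 0"
proof (rule lorB_neg_imp_snd_pos[OF assms(2,3)])
  show "lorq (lor_refl \<alpha> v) < 0"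
    using assms by (simp add: lorq_def lorB_lor_refl)
  have "lorB (lor_refl \<alpha> v) v = lorq v - 2 * (lorB \<alpha> v)\<^sup>2"
    by (simp add: lor_refl_def lorq_def power2_eq_square)
  then show "lorB (lor_refl \<alpha> v) v < 0"
    using assms(2) by (smt (verit) zero_le_power2)
qed

section \<open>Words and alternating words\<close>

definition word :: "('a::euclidean_space \<times> real) list \<Rightarrow> 'a \<times> real \<Rightarrow> 'a \<times> real" where
  "word xs = foldr (\<lambda>\<alpha> w. lor_refl \<alpha> \<circ> w) xs id"

lemma word_Nil [simp]: "word [] = id"
  and word_Cons [simp]: "word (\<alpha> # xs) = lor_refl \<alpha> \<circ> word xs"
  by (simp_all add: word_def)

lemma word_append: "word (xs @ ys) = word xs \<circ> word ys"
  by (induction xs) (simp_all add: comp_assoc)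

lemma linear_word: "linear (word xs)"
proof (induction xs)
  case Nil
  show ?case by (rule linearI) simp_all
next
  case (Cons \<alpha> xs)
  then show ?case unfolding word_Cons by (intro linear_compose linear_lor_refl)
qed

lemma word_orthogonal: "\<forall>\<alpha>\<in>set xs. lorB \<alpha> v = 0 \<Longrightarrow> word xs v = v"
  by (induction xs) (auto simp: lor_refl_orthogonal)

lemma coxeter_group_eq_words: "coxeter_group D = word ` lists D"
proof
  show "coxeter_group D \<subseteq> word ` lists D"
  proof
    fix w assume "w \<in> coxeter_group D"
    then show "w \<in> word ` lists D"
    proof induction
      case id_in
      then show ?case by (metis image_eqI lists.Nil word_Nil)
    next
      case (refl_comp \<alpha> w)
      then show ?case by (metis (no_types, lifting) image_iff lists.Cons word_Cons)
    qed
  qed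
  have "xs \<in> lists D \<Longrightarrow> word xs \<in> coxeter_group D" for xs
    by (induction xs) (auto intro: coxeter_group.intros)
  then show "word ` lists D \<subseteq> coxeter_group D" by auto
qed

text \<open>Words grow on the left, so that the last letter is always \<open>b\<close>.\<close>
primrec alt_word :: "'b \<Rightarrow> 'b \<Rightarrow> nat \<Rightarrow> 'b list" where
  "alt_word a b 0 = []"
| "alt_word a b (Suc k) = (if even k then b else a) # alt_word a b k"

lemma length_alt_word [simp]: "length (alt_word a b k) = k"
  by (induction k) auto

lemma set_alt_word: "set (alt_word a b k) \<subseteq> {a, b}"
  by (induction k) auto

lemma alt_word_snoc: "alt_word b a k @ [b] = alt_word a b (Suc k)"
  by (induction k) auto

lemma alt_word_add: "\<exists>ys. alt_word a b (j + m) = ys @ alt_word a b m \<and> length ys = j \<and> set ys \<subseteq> {a, b}"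
proof (induction j)
  case (Suc j)
  then obtain ys where "alt_word a b (j + m) = ys @ alt_word a b m" "length ys = j" "set ys \<subseteq> {a, b}"
    by blast
  then show ?case
    by (intro exI[of _ "(if even (j + m) then b else a) # ys"]) auto
qed auto

text \<open>Chebyshev polynomials of the second kind, with the index shifted so that
  \<open>cheb (cos \<theta>) k = sin (k \<theta>) / sin \<theta>\<close>.\<close>
fun cheb :: "real \<Rightarrow> nat \<Rightarrow> real" where
  "cheb c 0 = 0"
| "cheb c (Suc 0) = 1"
| "cheb c (Suc (Suc k)) = 2 * c * cheb c (Suc k) - cheb c k"

text \<open>The recursion of \<open>cheb\<close> is the addition theorem for the sine. Multiplying
  by \<open>sin \<theta>\<close> avoids a division.\<close>

lemma cheb_cos: "sin \<theta> * cheb (cos \<theta>) k = sin (real k * \<theta>)"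
proof (induction "cos \<theta>" k rule: cheb.induct)
  case (3 k)
  have "sin \<theta> * cheb (cos \<theta>) (Suc (Suc k)) =
      2 * cos \<theta> * (sin \<theta> * cheb (cos \<theta>) (Suc k)) - sin \<theta> * cheb (cos \<theta>) k"
    by (simp add: algebra_simps)
  also have "\<dots> = 2 * cos \<theta> * sin (real (Suc k) * \<theta>) - sin (real (Suc k) * \<theta> - \<theta>)"
    using 3 by (simp add: algebra_simps)
  also have "\<dots> = sin (real (Suc k) * \<theta> + \<theta>)"
    by (simp add: sin_add sin_diff)
  also have "\<dots> = sin (real (Suc (Suc k)) * \<theta>)"
    by (simp add: algebra_simps)
  finally show ?case .
qed auto

text \<open>Successive differences do not decrease, since 2c is at least 2. This serves pairs of
  simple roots with product at most -1.\<close>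

lemma cheb_ge_1:
  assumes "c \<ge> 1"
  shows "0 \<le> cheb c k \<and> cheb c k \<le> cheb c (Suc k)"
proof (induction k)
  case (Suc k)
  have "2 * c * cheb c (Suc k) \<ge> 2 * cheb c (Suc k)"
    using Suc assms mult_right_mono[of 2 "2 * c" "cheb c (Suc k)"] by auto
  then show ?case using Suc by simp
qed auto

text \<open>Reflecting x a + y b in b replaces y by 2c x - y. Each new letter hits the coefficient
  of lower index, so this is exactly the recursion of \<open>cheb\<close>.\<close>

lemma word_alt_word:
  assumes "lorB a a = 1" "lorB b b = 1" "lorB a b = - c"
  shows "word (alt_word a b k) a =
    (if even k then cheb c (Suc k) *\<^sub>R a + cheb c k *\<^sub>R b
     else cheb c (Suc k) *\<^sub>R b + cheb c k *\<^sub>R a)"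
proof (induction k)
  case (Suc k)
  have "lorB b a = - c" using assms(3) by (simp add: lorB_commute)
  then show ?case using Suc assms
    by (simp add: lor_refl_def algebra_simps flip: scaleR_2)
qed auto

text \<open>The product of a and b lies strictly between -1 and 1, so they span a nondegenerate
  plane. Both words fix its orthogonal complement, and the values of \<open>cheb\<close> at m - 1, m
  and m + 1 show that they agree on a and b.\<close>

lemma braid_relation:
  fixes a b :: "'a::euclidean_space \<times> real"
  assumes a: "lorB a a = 1" and b: "lorB b b = 1"
    and ab: "lorB a b = - cos (pi / real m)" and m: "m \<ge> 2"
  shows "word (alt_word a b m) = word (alt_word b a m)"
proof
  fix v
  define \<theta> c where "\<theta> = pi / real m" and "c = cos \<theta>"
  have \<theta>: "0 < \<theta>" "\<theta> < pi" using m by (auto simp: \<theta>_def field_simps)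
  have s: "sin \<theta> > 0" using \<theta> by (rule sin_gt_zero)
  obtain n where n: "m = Suc (Suc n)" using m by (metis add_2_eq_Suc le_Suc_ex)
  have m\<theta>: "real m * \<theta> = pi" using m by (simp add: \<theta>_def)
  have c0: "cheb c m = 0"
    using cheb_cos[of \<theta> m] s m\<theta> by (simp add: c_def)
  have "sin (real (Suc m) * \<theta>) = sin (pi + \<theta>)"
    using m\<theta> by (simp add: algebra_simps)
  then have c1: "cheb c (Suc m) = -1"
    using cheb_cos[of \<theta> "Suc m"] s unfolding c_def
    by (metis mult_cancel_left mult_minus1_right order_less_irrefl sin_periodic_pi2)
  have c2: "cheb c (Suc n) = 1"
    using c0 c1 by (simp add: n)
  have ab': "lorB a b = - c" "lorB b a = - c"
    using ab by (simp_all add: c_def \<theta>_def lorB_commute)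
  have aa: "word (alt_word x y m) x = (if even m then - x else - y)"
    if "lorB x x = 1" "lorB y y = 1" "lorB x y = - c" for x y :: "'a \<times> real"
    using word_alt_word[OF that, of m] by (simp only: c0 c1) simp
  \<comment> \<open>The last letter y acts first and only changes the sign of y; what remains is an
    alternating word of length m - 1 with the roles of x and y exchanged.\<close>
  have bb: "word (alt_word x y m) y = (if even m then - y else - x)"
    if h: "lorB x x = 1" "lorB y y = 1" "lorB x y = - c" "lorB y x = - c" for x y :: "'a \<times> real"
  proof -
    have "word (alt_word x y m) y = word (alt_word y x (Suc n)) (- y)"
      using alt_word_snoc[of y x "Suc n"] h
      by (metis comp_apply lor_refl_self n word_Cons word_Nil word_append comp_id)
    also have "\<dots> = - word (alt_word y x (Suc n)) y"
      by (rule linear_neg[OF linear_word])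
    also have "\<dots> = (if even m then - y else - x)"
      using word_alt_word[OF h(2,1,4), of "Suc n"] c0 c2 n by simp
    finally show ?thesis .
  qed
  have d: "1 - c\<^sup>2 \<noteq> 0"
    using s by (simp add: c_def cos_squared_eq)
  \<comment> \<open>These coefficients solve the Gram system of a and b, whose determinant is 1 -
    c^2, and make \<open>p\<close> orthogonal to both.\<close>
  define x y where "x = (lorB a v + c * lorB b v) / (1 - c\<^sup>2)"
    and "y = (lorB b v + c * lorB a v) / (1 - c\<^sup>2)"
  define p where "p = v - x *\<^sub>R a - y *\<^sub>R b"
  have xy: "x - c * y = lorB a v" "y - c * x = lorB b v"
  proof -
    have "x - c * y = (lorB a v * (1 - c\<^sup>2)) / (1 - c\<^sup>2)"
      "y - c * x = (lorB b v * (1 - c\<^sup>2)) / (1 - c\<^sup>2)"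
      unfolding x_def y_def times_divide_eq_right diff_divide_distrib[symmetric]
      by (simp_all add: algebra_simps power2_eq_square)
    then show "x - c * y = lorB a v" "y - c * x = lorB b v"
      using d by simp_all
  qed
  have p: "lorB a p = 0" "lorB b p = 0"
    using xy a b ab' by (simp_all add: p_def algebra_simps)
  have wp: "word (alt_word a b m) p = p" "word (alt_word b a m) p = p"
    using p set_alt_word[of a b m] set_alt_word[of b a m] by (auto intro!: word_orthogonal)
  have v: "v = x *\<^sub>R a + y *\<^sub>R b + p" by (simp add: p_def)
  have L: "word xs v = x *\<^sub>R word xs a + y *\<^sub>R word xs b + word xs p" for xs
    using linear_word[of xs] by (subst v) (simp add: linear_add linear_scale)
  show "word (alt_word a b m) v = word (alt_word b a m) v"
    unfolding L wp
    using aa[OF a b ab'(1)] aa[OF b a ab'(2)] bb[OF a b ab'] bb[OF b a ab'(2) ab'(1)] by simp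
qed

section \<open>The cone of positive roots\<close>

lemma pos_cone_base:
  assumes "finite D" "\<alpha> \<in> D"
  shows "\<alpha> \<in> pos_cone D"
proof -
  have "(\<Sum>\<beta>\<in>D. (if \<beta> = \<alpha> then 1 else 0) *\<^sub>R \<beta>) = \<alpha>"
    using assms by (simp add: if_distrib[of "\<lambda>c. c *\<^sub>R _"] cong: if_cong)
  then show ?thesis
    unfolding pos_cone_def by (intro CollectI exI[of _ "\<lambda>\<beta>. if \<beta> = \<alpha> then 1 else 0"]) auto
qed

lemma pos_cone_combination:
  assumes "u \<in> pos_cone D" "v \<in> pos_cone D" "a \<ge> 0" "b \<ge> 0"
  shows "a *\<^sub>R u + b *\<^sub>R v \<in> pos_cone D"
proof -
  obtain f g where f: "u = (\<Sum>\<alpha>\<in>D. f \<alpha> *\<^sub>R \<alpha>)" "\<forall>\<alpha>\<in>D. f \<alpha> \<ge> 0"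
    and g: "v = (\<Sum>\<alpha>\<in>D. g \<alpha> *\<^sub>R \<alpha>)" "\<forall>\<alpha>\<in>D. g \<alpha> \<ge> 0"
    using assms by (auto simp: pos_cone_def)
  have "a *\<^sub>R u + b *\<^sub>R v = (\<Sum>\<alpha>\<in>D. (a * f \<alpha> + b * g \<alpha>) *\<^sub>R \<alpha>)"
    by (simp add: f(1) g(1) scaleR_sum_right sum.distrib scaleR_add_left)
  then show ?thesis
    unfolding pos_cone_def using f g assms
    by (intro CollectI exI[of _ "\<lambda>\<alpha>. a * f \<alpha> + b * g \<alpha>"]) auto
qed

section \<open>Transfer of limit directions\<close>

text \<open>Discarding the finitely many values with \<open>h\<close> at most n leaves the limit
  point intact, so the n-th term can be chosen close to it with \<open>h\<close> above n.\<close>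

lemma islimpt_escaping_sequence:
  fixes f :: "'i \<Rightarrow> 'b::metric_space" and h :: "'i \<Rightarrow> real"
  assumes "x islimpt f ` A" and fin: "\<And>M. finite (f ` {i \<in> A. h i \<le> M})"
  obtains a :: "nat \<Rightarrow> 'i" where "\<And>n. a n \<in> A" "(\<lambda>n. f (a n)) \<longlonglongrightarrow> x"
    "filterlim (\<lambda>n. h (a n)) at_top sequentially"
proof -
  have "\<exists>i\<in>A. h i > real n \<and> dist (f i) x < inverse (real (Suc n))" for n
  proof -
    have "f ` A \<subseteq> f ` {i \<in> A. h i \<le> real n} \<union> f ` {i \<in> A. h i > real n}" by force
    then have "x islimpt f ` {i \<in> A. h i > real n}"
      using assms(1) islimpt_Un_finite[OF fin] islimpt_subset by metis
    then have "\<exists>y\<in>f ` {i \<in> A. h i > real n}. dist y x < inverse (real (Suc n))"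
      unfolding islimpt_approachable by (meson inverse_positive_iff_positive of_nat_0_less_iff zero_less_Suc)
    then show ?thesis by blast
  qed
  then obtain a where a: "\<And>n. a n \<in> A" "\<And>n. h (a n) > real n"
    "\<And>n. dist (f (a n)) x < inverse (real (Suc n))" by metis
  have "\<forall>\<^sub>F n in sequentially. norm (dist (f (a n)) x) \<le> inverse (real (Suc n))"
    using less_imp_le[OF a(3)] by simp
  then have "(\<lambda>n. dist (f (a n)) x) \<longlonglongrightarrow> 0"
    by (rule Lim_null_comparison) (rule LIMSEQ_inverse_real_of_nat)
  then have "(\<lambda>n. f (a n)) \<longlonglongrightarrow> x"
    by (rule iffD2[OF tendsto_dist_iff])
  moreover have "\<forall>\<^sub>F n in sequentially. real n \<le> h (a n)"
    using less_imp_le[OF a(2)] by simp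
  then have "filterlim (\<lambda>n. h (a n)) at_top sequentially"
    by (rule filterlim_at_top_mono[OF filterlim_real_sequentially])
  ultimately show ?thesis using that a(1) by blast
qed

lemma filterlim_abs_at_top:
  "filterlim f at_top F \<Longrightarrow> filterlim (\<lambda>n. \<bar>f n :: real\<bar>) at_top F"
  by (erule filterlim_at_top_mono) (simp add: abs_ge_self)

lemma lorq_hat: "lorq (hat v) = lorq v / (snd v)\<^sup>2"
  by (simp add: lorq_def hat_def power2_eq_square)

text \<open>The difference of two points of the affine hyperplane has last coordinate 0, and there
  \<open>lorq\<close> is the squared Euclidean norm.\<close>

lemma dist_hat_squared:
  assumes "snd u \<noteq> 0" "snd v \<noteq> 0"
  shows "(dist (hat u) (hat v))\<^sup>2 =
    lorq u / (snd u)\<^sup>2 + lorq v / (snd v)\<^sup>2 - 2 * (lorB u v / (snd u * snd v))"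
proof -
  have "snd (hat u - hat v) = 0" using assms by (simp add: hat_def)
  then have "(dist (hat u) (hat v))\<^sup>2 = lorq (hat u - hat v)"
    by (simp add: dist_norm lorq_eq norm_prod_def)
  also have "\<dots> = lorq (hat u) + lorq (hat v) - 2 * lorB (hat u) (hat v)"
    by (simp add: lorq_def lorB_commute[of "hat v" "hat u"])
  finally show ?thesis by (simp add: lorq_hat) (simp add: hat_def)
qed

text \<open>The distance identity sends \<open>hat (u n)\<close> to \<open>x\<close> as well. The
  limit is isotropic while \<open>hat (u n)\<close> is not, so the sequence eventually avoids
  \<open>x\<close> and makes it a genuine accumulation point.\<close>

lemma islimpt_hat_transfer:
  fixes u v :: "nat \<Rightarrow> 'a::euclidean_space \<times> real"
  assumes v: "(\<lambda>n. hat (v n)) \<longlonglongrightarrow> x"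
    and qu: "\<And>n. \<bar>lorq (u n)\<bar> \<le> C" and qv: "\<And>n. \<bar>lorq (v n)\<bar> \<le> C"
    and su: "filterlim (\<lambda>n. \<bar>snd (u n)\<bar>) at_top sequentially"
    and sv: "filterlim (\<lambda>n. \<bar>snd (v n)\<bar>) at_top sequentially"
    and uv: "(\<lambda>n. lorB (u n) (v n) / (snd (u n) * snd (v n))) \<longlonglongrightarrow> 0"
    and ne: "\<And>n. lorq (u n) \<noteq> 0" and S: "\<forall>\<^sub>F n in sequentially. hat (u n) \<in> S"
  shows "x islimpt S"
proof -
  have q0: "(\<lambda>n. lorq (w n) / (snd (w n))\<^sup>2) \<longlonglongrightarrow> 0"
    if w: "\<And>n. \<bar>lorq (w n)\<bar> \<le> C" "filterlim (\<lambda>n. \<bar>snd (w n)\<bar>) at_top sequentially"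
    for w :: "nat \<Rightarrow> 'a \<times> real"
  proof (rule Lim_null_comparison)
    show "(\<lambda>n. C / \<bar>snd (w n)\<bar>\<^sup>2) \<longlonglongrightarrow> 0"
      by (intro tendsto_divide_0[OF tendsto_const] filterlim_at_top_imp_at_infinity
          filterlim_pow_at_top w(2)) simp
    show "\<forall>\<^sub>F n in sequentially. norm (lorq (w n) / (snd (w n))\<^sup>2) \<le> C / \<bar>snd (w n)\<bar>\<^sup>2"
      using w(1) by (simp add: divide_right_mono)
  qed
  have nz: "\<forall>\<^sub>F n in sequentially. snd (w n) \<noteq> 0"
    if "filterlim (\<lambda>n. \<bar>snd (w n)\<bar>) at_top sequentially" for w :: "nat \<Rightarrow> 'a \<times> real"
  proof -
    have "\<forall>\<^sub>F n in sequentially. \<bar>snd (w n)\<bar> \<ge> 1" using that by (simp add: filterlim_at_top)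
    then show ?thesis by eventually_elim auto
  qed
  have "(\<lambda>n. lorq (u n) / (snd (u n))\<^sup>2 + lorq (v n) / (snd (v n))\<^sup>2
      - 2 * (lorB (u n) (v n) / (snd (u n) * snd (v n)))) \<longlonglongrightarrow> 0 + 0 - 2 * 0"
    by (intro tendsto_intros q0 qu qv su sv uv)
  moreover have "\<forall>\<^sub>F n in sequentially. lorq (u n) / (snd (u n))\<^sup>2 + lorq (v n) / (snd (v n))\<^sup>2
      - 2 * (lorB (u n) (v n) / (snd (u n) * snd (v n))) = (dist (hat (u n)) (hat (v n)))\<^sup>2"
    using nz[OF su] nz[OF sv] by eventually_elim (rule dist_hat_squared[symmetric])
  ultimately have "(\<lambda>n. (dist (hat (u n)) (hat (v n)))\<^sup>2) \<longlonglongrightarrow> 0"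
    by (simp add: tendsto_cong)
  then have "(\<lambda>n. dist (hat (u n)) (hat (v n))) \<longlonglongrightarrow> 0"
    using tendsto_real_sqrt by fastforce
  then have "(\<lambda>n. hat (u n) - hat (v n)) \<longlonglongrightarrow> 0"
    by (simp add: dist_norm tendsto_norm_zero_iff)
  from tendsto_add[OF this v] have u: "(\<lambda>n. hat (u n)) \<longlonglongrightarrow> x" by simp
  have "(\<lambda>n. lorq (hat (u n))) \<longlonglongrightarrow> lorq x"
    unfolding lorq_def lorB_def by (intro tendsto_intros u)
  moreover have "(\<lambda>n. lorq (hat (u n))) \<longlonglongrightarrow> 0"
    unfolding lorq_hat by (rule q0[OF qu su])
  ultimately have x: "lorq x = 0" by (rule LIMSEQ_unique)
  have "\<forall>\<^sub>F n in sequentially. hat (u n) \<in> S \<and> hat (u n) \<noteq> x"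
    using S nz[OF su]
  proof eventually_elim
    case (elim n)
    have "lorq (hat (u n)) \<noteq> 0" using ne[of n] elim by (simp add: lorq_hat)
    then show ?case using elim x by auto
  qed
  note ev = this
  show ?thesis
    unfolding islimpt_approachable
  proof (intro allI impI)
    fix e :: real assume "e > 0"
    then have "\<forall>\<^sub>F n in sequentially. dist (hat (u n)) x < e" using u tendstoD by blast
    with ev have "\<forall>\<^sub>F n in sequentially. hat (u n) \<in> S \<and> hat (u n) \<noteq> x \<and> dist (hat (u n)) x < e"
      by eventually_elim auto
    then show "\<exists>x'\<in>S. x' \<noteq> x \<and> dist x' x < e"
      using eventually_happens' sequentially_bot by blast
  qed
qed

section \<open>Length and positivity\<close>

locale future_simple_system =
  fixes \<Delta> :: "('a::euclidean_space \<times> real) set"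
  assumes simple: "simple_system \<Delta>"
    and snd_pos: "\<alpha> \<in> \<Delta> \<Longrightarrow> snd \<alpha> > 0"
begin

abbreviation "W \<equiv> coxeter_group \<Delta>"

lemma finite_simple: "finite \<Delta>"
  using simple by (simp add: simple_system_def)

lemma lorB_simple_self: "\<alpha> \<in> \<Delta> \<Longrightarrow> lorB \<alpha> \<alpha> = 1"
  using simple by (simp add: simple_system_def)

lemma lorB_simple_cases:
  assumes "\<alpha> \<in> \<Delta>" "\<beta> \<in> \<Delta>" "\<alpha> \<noteq> \<beta>"
  obtains "lorB \<alpha> \<beta> \<le> -1" | m :: nat where "m \<ge> 2" "lorB \<alpha> \<beta> = - cos (pi / real m)"
  using assms simple unfolding simple_system_def by metis

lemma lorB_simple_nonpos:
  assumes "\<alpha> \<in> \<Delta>" "\<beta> \<in> \<Delta>" "\<alpha> \<noteq> \<beta>"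
  shows "lorB \<alpha> \<beta> \<le> 0"
  using assms
proof (cases rule: lorB_simple_cases)
  case (2 m)
  then have "cos (pi / real m) \<ge> 0"
    by (intro cos_ge_zero) (auto simp: field_simps intro: order_trans[of _ 0])
  with 2 show ?thesis by simp
qed auto

lemma word_in_W: "set xs \<subseteq> \<Delta> \<Longrightarrow> word xs \<in> W"
  by (auto simp: coxeter_group_eq_words)

lemma W_wordE:
  assumes "w \<in> W"
  obtains xs where "set xs \<subseteq> \<Delta>" "w = word xs"
  using assms by (auto simp: coxeter_group_eq_words)

lemma refl_in_W: "\<alpha> \<in> \<Delta> \<Longrightarrow> lor_refl \<alpha> \<in> W"
  using word_in_W[of "[\<alpha>]"] by simp

lemma comp_in_W: "v \<in> W \<Longrightarrow> w \<in> W \<Longrightarrow> v \<circ> w \<in> W"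
  by (elim W_wordE) (auto simp flip: word_append intro!: word_in_W)

lemma linear_W: "w \<in> W \<Longrightarrow> linear w"
  by (elim W_wordE) (simp add: linear_word)

lemma lorB_W: "w \<in> W \<Longrightarrow> lorB (w u) (w v) = lorB u v"
  by (induction rule: coxeter_group.induct) (auto simp: lorB_lor_refl lorB_simple_self)

lemma lorq_W: "w \<in> W \<Longrightarrow> lorq (w v) = lorq v"
  by (simp add: lorq_def lorB_W)

lemma W_inverse:
  assumes "w \<in> W"
  obtains w' where "w' \<in> W" "w \<circ> w' = id" "w' \<circ> w = id"
proof -
  have "\<exists>w'\<in>W. w \<circ> w' = id \<and> w' \<circ> w = id"
    using assms
  proof induction
    case id_in
    then show ?case by (intro bexI[of _ id] coxeter_group.id_in) simp
  next
    case (refl_comp \<alpha> w)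
    then obtain w' where w': "w' \<in> W" "w \<circ> w' = id" "w' \<circ> w = id" by blast
    then have "\<And>x. w (w' x) = x" "\<And>x. w' (w x) = x"
      by (metis comp_apply id_apply)+
    then show ?case using w' refl_comp
      by (intro bexI[of _ "w' \<circ> lor_refl \<alpha>"])
        (auto simp: fun_eq_iff lor_refl_invol lorB_simple_self intro: comp_in_W refl_in_W)
  qed
  then show ?thesis using that by blast
qed

text \<open>This keeps the orbit of the base point on the upper sheet, where \<open>hat\<close>
  divides by a positive number.\<close>

lemma snd_W_pos:
  assumes "w \<in> W" "lorq v < 0" "snd v > 0"
  shows "snd (w v) > 0"
  using assms(1)
  by induction (use assms in \<open>auto simp: lorq_W lorB_simple_self intro!: lor_refl_future\<close>)

definition wlen :: "('a \<times> real \<Rightarrow> 'a \<times> real) \<Rightarrow> nat" where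
  "wlen w = (LEAST n. \<exists>xs. set xs \<subseteq> \<Delta> \<and> length xs = n \<and> word xs = w)"

lemma wlen_le: "set xs \<subseteq> \<Delta> \<Longrightarrow> wlen (word xs) \<le> length xs"
  unfolding wlen_def by (rule Least_le) blast

lemma reduced_word:
  assumes "w \<in> W"
  obtains xs where "set xs \<subseteq> \<Delta>" "length xs = wlen w" "word xs = w"
proof -
  have "\<exists>n. \<exists>xs. set xs \<subseteq> \<Delta> \<and> length xs = n \<and> word xs = w"
    using assms by (metis W_wordE)
  from LeastI_ex[OF this] show ?thesis
    using that unfolding wlen_def by blast
qed

lemma wlen_comp_word:
  assumes "v \<in> W" "set xs \<subseteq> \<Delta>"
  shows "wlen (v \<circ> word xs) \<le> wlen v + length xs"
proof -
  obtain ys where ys: "set ys \<subseteq> \<Delta>" "length ys = wlen v" "word ys = v"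
    using reduced_word[OF assms(1)] .
  then show ?thesis
    using wlen_le[of "ys @ xs"] assms by (simp add: word_append)
qed

lemma last_reflection:
  assumes "w \<in> W" "wlen w > 0"
  obtains v \<alpha> where "v \<in> W" "\<alpha> \<in> \<Delta>" "w = v \<circ> lor_refl \<alpha>" "wlen v = wlen w - 1"
proof -
  obtain xs where xs: "set xs \<subseteq> \<Delta>" "length xs = wlen w" "word xs = w"
    using reduced_word[OF assms(1)] .
  then obtain ys \<alpha> where ys: "xs = ys @ [\<alpha>]"
    using assms(2) by (metis length_greater_0_conv rev_exhaust)
  have y: "set ys \<subseteq> \<Delta>" "\<alpha> \<in> \<Delta>" using xs ys by auto
  have w: "w = word ys \<circ> lor_refl \<alpha>"
    using xs(3) ys by (simp add: word_append)
  have "wlen w \<le> wlen (word ys) + 1"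
    using wlen_comp_word[of "word ys" "[\<alpha>]"] y w word_in_W by simp
  moreover have "wlen (word ys) \<le> wlen w - 1"
    using wlen_le[OF y(1)] xs ys by simp
  ultimately show ?thesis
    using that[OF word_in_W[OF y(1)] y(2) w] assms(2) by linarith
qed

text \<open>Split off from the right of \<open>w\<close> the longest possible alternating word in \<open>\<alpha>\<close> and
  the last letter \<open>\<beta>\<close> of a reduced expression.  The remaining factor is not shortened by \<open>\<alpha>\<close>
  or \<open>\<beta>\<close>, so by induction it maps both into the cone; the alternating word maps \<open>\<alpha>\<close> to a
  combination of \<open>\<alpha>\<close> and \<open>\<beta>\<close> with Chebyshev coefficients.\<close>
theorem length_increasing_imp_positive:
  assumes "w \<in> W" "\<alpha> \<in> \<Delta>" "wlen w \<le> wlen (w \<circ> lor_refl \<alpha>)"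
  shows "w \<alpha> \<in> pos_cone \<Delta>"
  using assms
proof (induction "wlen w" arbitrary: w \<alpha> rule: less_induct)
  case less
  note w = less.prems(1) and \<alpha> = less.prems(2) and inc = less.prems(3)
  show ?case
  proof (cases "wlen w = 0")
    case True
    then have "w = id" using reduced_word[OF w] by auto
    then show ?thesis using pos_cone_base[OF finite_simple \<alpha>] by simp
  next
    case False
    then obtain v0 \<beta> where v0: "v0 \<in> W" "\<beta> \<in> \<Delta>" "w = v0 \<circ> lor_refl \<beta>" "wlen v0 = wlen w - 1"
      using last_reflection[OF w] by blast
    have "\<alpha> \<noteq> \<beta>"
    proof
      assume "\<alpha> = \<beta>"
      then have "w \<circ> lor_refl \<alpha> = v0"
        using v0 \<alpha> by (simp add: comp_assoc lor_refl_comp_self lorB_simple_self)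
      then show False using inc v0 False by simp
    qed
    define good where "good k \<longleftrightarrow> (\<exists>v\<in>W. w = v \<circ> word (alt_word \<alpha> \<beta> k) \<and> wlen v + k = wlen w)" for k
    have set_alt: "set (alt_word \<alpha> \<beta> k) \<subseteq> \<Delta>" "set (alt_word \<beta> \<alpha> k) \<subseteq> \<Delta>" for k
      using set_alt_word[of \<alpha> \<beta> k] set_alt_word[of \<beta> \<alpha> k] \<alpha> v0(2) by auto
    have g1: "good 1"
      unfolding good_def using v0 False by (intro bexI[of _ v0]) auto
    have gb: "k \<le> wlen w" if "good k" for k
      using that by (auto simp: good_def)
    define k where "k = (GREATEST k. good k)"
    have gk: "good k" unfolding k_def using g1 gb by (rule GreatestI_nat)
    have kmax: "j \<le> k" if "good j" for j
      unfolding k_def using that gb by (rule Greatest_le_nat)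
    have k1: "k \<ge> 1" using kmax g1 .
    from gk obtain v where v: "v \<in> W" "w = v \<circ> word (alt_word \<alpha> \<beta> k)" "wlen v + k = wlen w"
      by (auto simp: good_def)
    \<comment> \<open>\<open>r\<close> is the letter that would extend the alternating word on the
      left, \<open>r'\<close> is its present leftmost letter; together they are \<alpha> and
      \<beta>.\<close>
    define r r' where "r = (if even k then \<beta> else \<alpha>)" and "r' = (if even k then \<alpha> else \<beta>)"
    have r: "r \<in> \<Delta>" "r' \<in> \<Delta>" using \<alpha> v0 by (auto simp: r_def r'_def)
    have inv: "lor_refl x \<circ> (lor_refl x \<circ> f) = f" if "x \<in> \<Delta>" for x and f :: "'a \<times> real \<Rightarrow> 'a \<times> real"
      using that by (simp add: comp_assoc[symmetric] lor_refl_comp_self lorB_simple_self)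
    \<comment> \<open>If \<open>r\<close> shortened \<open>v\<close>, a longer alternating word
      could be split off, against the maximality of \<open>k\<close>.\<close>
    have r_inc: "wlen v \<le> wlen (v \<circ> lor_refl r)"
    proof (rule ccontr)
      assume "\<not> ?thesis"
      moreover have vr: "v \<circ> lor_refl r \<in> W" using v r by (intro comp_in_W refl_in_W)
      moreover have e: "w = (v \<circ> lor_refl r) \<circ> word (alt_word \<alpha> \<beta> (Suc k))"
        using v(2) inv[OF r(1)] by (simp add: r_def comp_assoc)
      moreover have "wlen w \<le> wlen (v \<circ> lor_refl r) + Suc k"
        using wlen_comp_word[OF vr set_alt(1)[of "Suc k"]] e by simp
      ultimately have "good (Suc k)"
        unfolding good_def using v(3) by (intro bexI[OF _ vr]) auto
      then show False using kmax by fastforce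
    qed
    \<comment> \<open>Here \<open>r'\<close> cancels against the leftmost letter; if it also
      shortened \<open>v\<close>, then \<open>w\<close> would have too short an expression.\<close>
    have r'_inc: "wlen v \<le> wlen (v \<circ> lor_refl r')"
    proof (rule ccontr)
      assume n: "\<not> ?thesis"
      have vr: "v \<circ> lor_refl r' \<in> W" using v r by (intro comp_in_W refl_in_W)
      obtain j where j: "k = Suc j" using k1 by (cases k) auto
      have "w = (v \<circ> lor_refl r') \<circ> word (alt_word \<alpha> \<beta> j)"
        using v(2) j inv[OF r(2)] by (simp add: r'_def comp_assoc)
      then have "wlen w \<le> wlen (v \<circ> lor_refl r') + j"
        using wlen_comp_word[OF vr set_alt(1)[of j]] by simp
      then show False using n v(3) j by simp
    qed
    have IH: "v x \<in> pos_cone \<Delta>" if "x \<in> {\<alpha>, \<beta>}" for x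
      using less.hyps[of v r] less.hyps[of v r'] v k1 r r_inc r'_inc that
      by (auto simp: r_def r'_def split: if_splits)
    define c where "c = - lorB \<alpha> \<beta>"
    have B: "lorB \<alpha> \<alpha> = 1" "lorB \<beta> \<beta> = 1" "lorB \<alpha> \<beta> = - c"
      using \<alpha> v0 by (simp_all add: lorB_simple_self c_def)
    have cheb: "cheb c k \<ge> 0 \<and> cheb c (Suc k) \<ge> 0"
      using \<alpha> v0(2) \<open>\<alpha> \<noteq> \<beta>\<close>
    proof (cases rule: lorB_simple_cases)
      case 1
      then show ?thesis using cheb_ge_1[of c k] cheb_ge_1[of c "Suc k"] by (simp add: c_def)
    next
      case (2 m)
      \<comment> \<open>Otherwise the braid relation rewrites the rightmost m letters so as to end
        in \<alpha>, and \<alpha> would shorten \<open>w\<close>.\<close>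
      have km: "k < m"
      proof (rule ccontr)
        assume "\<not> k < m"
        then obtain j where j: "k = j + m" by (metis add.commute le_Suc_ex not_less)
        obtain n where n: "m = Suc n" using 2 by (cases m) auto
        obtain ys where ys: "alt_word \<alpha> \<beta> k = ys @ alt_word \<alpha> \<beta> m" "length ys = j" "set ys \<subseteq> {\<alpha>, \<beta>}"
          using alt_word_add[of \<alpha> \<beta> j m] j by auto
        have "word (alt_word \<alpha> \<beta> m) = word (alt_word \<alpha> \<beta> n) \<circ> lor_refl \<alpha>"
          using braid_relation[OF B(1,2) 2(2,1)] alt_word_snoc[of \<alpha> \<beta> n] n
          by (metis comp_id word_Cons word_Nil word_append)
        then have "w \<circ> lor_refl \<alpha> = v \<circ> word (ys @ alt_word \<alpha> \<beta> n)"
          using v(2) ys B by (simp add: word_append comp_assoc lor_refl_comp_self)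
        moreover have "set (ys @ alt_word \<alpha> \<beta> n) \<subseteq> \<Delta>" using ys(3) set_alt \<alpha> v0(2) by auto
        ultimately have "wlen (w \<circ> lor_refl \<alpha>) \<le> wlen v + (j + n)"
          using wlen_comp_word[OF v(1)] ys(2) by (metis length_alt_word length_append)
        then show False using inc v(3) j n by simp
      qed
      define \<theta> where "\<theta> = pi / real m"
      have \<theta>: "0 < \<theta>" "\<theta> < pi" using 2 by (auto simp: \<theta>_def field_simps)
      have s: "sin \<theta> > 0" using \<theta> by (rule sin_gt_zero)
      \<comment> \<open>Up to index m the angle stays within [0, \<pi>], where the sine is
        nonnegative.\<close>
      have "cheb c i \<ge> 0" if "i \<le> m" for i
      proof -
        have "real i * \<theta> \<le> pi" using that 2 by (simp add: \<theta>_def field_simps)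
        then have "sin \<theta> * cheb (cos \<theta>) i \<ge> 0"
          using \<theta> by (simp add: cheb_cos sin_ge_zero)
        then show ?thesis using s 2 by (simp add: c_def \<theta>_def zero_le_mult_iff)
      qed
      then show ?thesis using km by simp
    qed
    have "w \<alpha> = v (word (alt_word \<alpha> \<beta> k) \<alpha>)" using v(2) by simp
    also have "\<dots> = (if even k then cheb c (Suc k) *\<^sub>R v \<alpha> + cheb c k *\<^sub>R v \<beta>
                else cheb c (Suc k) *\<^sub>R v \<beta> + cheb c k *\<^sub>R v \<alpha>)"
      using linear_W[OF v(1)] unfolding word_alt_word[OF B] by (simp add: linear_add linear_scale del: cheb.simps)
    also have "\<dots> \<in> pos_cone \<Delta>"
      using IH[of \<alpha>] IH[of \<beta>] cheb by (auto intro!: pos_cone_combination simp del: cheb.simps)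
    finally show ?thesis .
  qed
qed

text \<open>Take for \<alpha> the last letter of a reduced expression: the rest \<open>v\<close> is
  lengthened by \<alpha>, so \<open>v \<alpha>\<close> is positive, and
  \<open>w \<alpha> = - v \<alpha>\<close>.\<close>

corollary exists_negative_image:
  assumes "w \<in> W" "w \<noteq> id"
  obtains \<alpha> where "\<alpha> \<in> \<Delta>" "- w \<alpha> \<in> pos_cone \<Delta>"
proof -
  have "wlen w > 0"
    by (rule reduced_word[OF assms(1)]) (use assms(2) in auto)
  then obtain v \<alpha> where v: "v \<in> W" "\<alpha> \<in> \<Delta>" "w = v \<circ> lor_refl \<alpha>" "wlen v = wlen w - 1"
    using last_reflection[OF assms(1)] by blast
  then have "v \<alpha> \<in> pos_cone \<Delta>"
    by (intro length_increasing_imp_positive) auto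
  moreover have "w \<alpha> = - v \<alpha>"
    using v linear_W[OF v(1)] by (simp add: lor_refl_self lorB_simple_self linear_neg)
  ultimately show ?thesis using that v(2) by auto
qed


section \<open>Discreteness of the orbit of the base point\<close>

text \<open>Off-diagonal entries of the Gram matrix are nonpositive, so the coefficients of a
  unit vector of the cone have square sum at least 1.\<close>
lemma snd_positive_unit_bound:
  obtains \<epsilon> where "\<epsilon> > 0" "\<And>\<beta>. \<beta> \<in> pos_cone \<Delta> \<Longrightarrow> lorq \<beta> = 1 \<Longrightarrow> snd \<beta> \<ge> \<epsilon>"
proof -
  define \<mu> where "\<mu> = Min (insert 1 (snd ` \<Delta>))"
  have \<mu>: "\<mu> > 0" "\<And>\<alpha>. \<alpha> \<in> \<Delta> \<Longrightarrow> \<mu> \<le> snd \<alpha>"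
    using finite_simple snd_pos by (auto simp: \<mu>_def)
  have "snd \<beta> \<ge> \<mu>" if \<beta>: "\<beta> \<in> pos_cone \<Delta>" and q: "lorq \<beta> = 1" for \<beta>
  proof -
    obtain c where c: "\<beta> = (\<Sum>\<alpha>\<in>\<Delta>. c \<alpha> *\<^sub>R \<alpha>)" "\<forall>\<alpha>\<in>\<Delta>. c \<alpha> \<ge> 0"
      using \<beta> unfolding pos_cone_def by blast
    have "lorB \<alpha> \<beta> \<le> c \<alpha>" if \<alpha>: "\<alpha> \<in> \<Delta>" for \<alpha>
    proof -
      have "lorB \<alpha> \<beta> = (\<Sum>\<gamma>\<in>\<Delta>. c \<gamma> * lorB \<alpha> \<gamma>)"
        by (simp add: c(1) linear_sum[OF linear_lorB])
      also have "\<dots> \<le> (\<Sum>\<gamma>\<in>\<Delta>. if \<gamma> = \<alpha> then c \<gamma> else 0)"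
        using \<alpha> c(2) by (intro sum_mono) (auto simp: lorB_simple_self lorB_simple_nonpos mult_nonneg_nonpos)
      also have "\<dots> = c \<alpha>" using \<alpha> finite_simple by simp
      finally show ?thesis .
    qed
    note le = this
    have "1 = lorB \<beta> \<beta>" using q by (simp add: lorq_def)
    also have "\<dots> = (\<Sum>\<alpha>\<in>\<Delta>. c \<alpha> * lorB \<beta> \<alpha>)"
      by (subst (2) c(1)) (simp add: linear_sum[OF linear_lorB])
    also have "\<dots> \<le> (\<Sum>\<alpha>\<in>\<Delta>. c \<alpha> * c \<alpha>)"
      using le c(2) by (intro sum_mono mult_left_mono) (auto simp: lorB_commute[of \<beta>])
    \<comment> \<open>For nonnegative coefficients the square sum is at most the square of the sum.
      Hence the sum is at least 1, and \<mu> turns this into a bound on the last coordinate.\<close>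
    also have "\<dots> \<le> (\<Sum>\<alpha>\<in>\<Delta>. c \<alpha> * (\<Sum>\<gamma>\<in>\<Delta>. c \<gamma>))"
      using c(2) finite_simple by (intro sum_mono mult_left_mono member_le_sum) auto
    also have "\<dots> = (\<Sum>\<alpha>\<in>\<Delta>. c \<alpha>)\<^sup>2"
      by (simp add: sum_distrib_right power2_eq_square)
    finally have "1 \<le> (\<Sum>\<alpha>\<in>\<Delta>. c \<alpha>)"
      using c(2) by (metis one_power2 power2_le_imp_le sum_nonneg)
    then have "\<mu> \<le> (\<Sum>\<alpha>\<in>\<Delta>. c \<alpha>) * \<mu>" using \<mu>(1) by simp
    also have "\<dots> \<le> (\<Sum>\<alpha>\<in>\<Delta>. c \<alpha> * snd \<alpha>)"
      using \<mu>(2) c(2) by (auto simp: sum_distrib_right intro!: sum_mono mult_left_mono)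
    also have "\<dots> = snd \<beta>" by (simp add: c(1) snd_sum)
    finally show ?thesis .
  qed
  then show ?thesis using that \<mu>(1) by blast
qed

text \<open>Invariance moves \<open>w\<close> across the form; estimates for the inverse thus become
  estimates for \<open>w\<close>.\<close>

lemma snd_inverse_eq:
  assumes "w \<in> W" "w' \<in> W" "w' \<circ> w = id"
  shows "snd (w' e_last) = snd (w e_last)"
proof -
  have "lorB e_last (w' e_last) = lorB (w e_last) e_last"
    using lorB_W[OF assms(2), of "w e_last" e_last] assms(3)
    by (metis comp_apply id_apply)
  then show ?thesis by (simp add: lorB_e_last lorB_commute[of "w e_last"])
qed

text \<open>Some \<open>w \<alpha>\<close> is negative, so the hyperplane orthogonal to \<open>\<alpha>\<close> separates the base point from
  its image under the inverse of \<open>w\<close>, with a margin on both sides.\<close>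
lemma snd_orbit_gap:
  obtains \<delta> where "\<delta> > 0" "\<And>w. w \<in> W \<Longrightarrow> w \<noteq> id \<Longrightarrow> snd (w e_last) \<ge> 1 + \<delta>"
proof -
  obtain \<epsilon> where \<epsilon>: "\<epsilon> > 0" "\<And>\<beta>. \<beta> \<in> pos_cone \<Delta> \<Longrightarrow> lorq \<beta> = 1 \<Longrightarrow> snd \<beta> \<ge> \<epsilon>"
    using snd_positive_unit_bound by blast
  define K where "K = Max (insert 1 ((\<lambda>\<alpha>. norm (fst \<alpha>)) ` \<Delta>))"
  have K: "K > 0" "\<And>\<alpha>. \<alpha> \<in> \<Delta> \<Longrightarrow> norm (fst \<alpha>) \<le> K"
  proof -
    have "1 \<le> K" using finite_simple by (simp add: K_def)
    then show "K > 0" by simp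
    show "norm (fst \<alpha>) \<le> K" if "\<alpha> \<in> \<Delta>" for \<alpha>
      using finite_simple that by (auto simp: K_def intro!: Max_ge)
  qed
  \<comment> \<open>On the hyperboloid the last coordinate is the root of 1 plus the squared spatial
    norm; the spatial norm will be at least \<epsilon>/K.\<close>
  define \<delta> where "\<delta> = sqrt (1 + (\<epsilon> / K)\<^sup>2) - 1"
  have "\<delta> > 0" using \<epsilon>(1) K(1) by (simp add: \<delta>_def)
  moreover have "snd (w e_last) \<ge> 1 + \<delta>" if w: "w \<in> W" "w \<noteq> id" for w
  proof -
    obtain \<alpha> where \<alpha>: "\<alpha> \<in> \<Delta>" "- w \<alpha> \<in> pos_cone \<Delta>"
      using exists_negative_image[OF w] .
    have "lorq (- w \<alpha>) = 1"
      using w \<alpha> by (simp add: lorq_def lorB_W lorB_simple_self)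
    then have sb: "snd (- w \<alpha>) \<ge> \<epsilon>" using \<epsilon>(2) \<alpha>(2) by blast
    obtain w' where w': "w' \<in> W" "w \<circ> w' = id" "w' \<circ> w = id"
      using W_inverse[OF w(1)] .
    define y where "y = w' e_last"
    have wy: "w y = e_last" unfolding y_def using w'(2) by (metis comp_apply id_apply)
    have y: "snd y > 0" "lorq y = -1"
      using w' by (simp_all add: y_def lorq_W lorq_e_last snd_W_pos)
    have "lorB y \<alpha> = lorB e_last (w \<alpha>)"
      using lorB_W[OF w(1), of y \<alpha>] wy by simp
    then have "fst y \<bullet> fst \<alpha> - snd y * snd \<alpha> \<ge> \<epsilon>"
      using sb unfolding lorB_e_last by (simp add: lorB_def)
    moreover have "snd y * snd \<alpha> > 0" using y(1) snd_pos[OF \<alpha>(1)] by simp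
    moreover have "fst y \<bullet> fst \<alpha> \<le> norm (fst y) * norm (fst \<alpha>)" by (rule norm_cauchy_schwarz)
    moreover have "norm (fst y) * norm (fst \<alpha>) \<le> norm (fst y) * K"
      using K(2)[OF \<alpha>(1)] by (intro mult_left_mono) auto
    ultimately have "\<epsilon> \<le> norm (fst y) * K" by linarith
    then have "\<epsilon> / K \<le> norm (fst y)" using K(1) by (simp add: field_simps)
    then have "(\<epsilon> / K)\<^sup>2 \<le> (norm (fst y))\<^sup>2" using \<epsilon>(1) K(1) by (intro power_mono) auto
    then have "1 + (\<epsilon> / K)\<^sup>2 \<le> (snd y)\<^sup>2" using y(2) by (simp add: lorq_eq)
    then have "sqrt (1 + (\<epsilon> / K)\<^sup>2) \<le> snd y" using y(1) by (simp add: real_le_lsqrt)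
    then show ?thesis
      using snd_inverse_eq[OF w(1) w'(1,3)] by (simp add: \<delta>_def y_def)
  qed
  ultimately show ?thesis using that by blast
qed

text \<open>Applied to the quotient of two distinct elements, the gap bounds the distance of their
  orbit points from below. Bounded height bounds the norm on the hyperboloid, and a bounded
  uniformly discrete set is finite.\<close>

lemma finite_W_bounded: "finite {w \<in> W. snd (w e_last) \<le> M}"
proof -
  obtain \<delta> where \<delta>: "\<delta> > 0" "\<And>w. w \<in> W \<Longrightarrow> w \<noteq> id \<Longrightarrow> snd (w e_last) \<ge> 1 + \<delta>"
    using snd_orbit_gap by blast
  define A where "A = {w \<in> W. snd (w e_last) \<le> M}"
  have sep: "sqrt (2 * \<delta>) \<le> dist (v e_last) (w e_last)" if vw: "v \<in> W" "w \<in> W" "v \<noteq> w" for v w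
  proof -
    obtain v' where v': "v' \<in> W" "v \<circ> v' = id" "v' \<circ> v = id" using W_inverse[OF vw(1)] .
    have "v' \<circ> w \<noteq> id"
      using v'(2) vw(3) by (metis comp_assoc comp_id id_comp)
    then have "snd ((v' \<circ> w) e_last) \<ge> 1 + \<delta>" using \<delta>(2) comp_in_W v'(1) vw(2) by blast
    moreover have "lorB (v e_last) (w e_last) = lorB e_last ((v' \<circ> w) e_last)"
      using lorB_W[OF v'(1), of "v e_last" "w e_last"] v'(3) by (metis comp_apply id_apply)
    ultimately have "lorB (v e_last) (w e_last) \<le> - 1 - \<delta>" by (simp add: lorB_e_last)
    moreover have "lorq (v e_last - w e_last) = lorq (v e_last) + lorq (w e_last) - 2 * lorB (v e_last) (w e_last)"
      by (simp add: lorq_def lorB_commute[of "w e_last" "v e_last"])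
    ultimately have "2 * \<delta> \<le> lorq (v e_last - w e_last)"
      using vw by (simp add: lorq_W lorq_e_last)
    also have "\<dots> \<le> (dist (v e_last) (w e_last))\<^sup>2" unfolding dist_norm by (rule lorq_le_norm)
    finally show ?thesis by (simp add: real_le_lsqrt)
  qed
  have s0: "sqrt (2 * \<delta>) > 0" using \<delta>(1) by simp
  have inj: "inj_on (\<lambda>w. w e_last) A"
    using sep s0 by (force simp: inj_on_def A_def)
  have "uniform_discrete ((\<lambda>w. w e_last) ` A)"
    unfolding uniform_discrete_def
  proof (intro exI conjI ballI impI)
    fix x y assume "x \<in> (\<lambda>w. w e_last) ` A" "y \<in> (\<lambda>w. w e_last) ` A" "dist x y < sqrt (2 * \<delta>)"
    then show "x = y" using sep unfolding A_def by (smt (verit) image_iff mem_Collect_eq)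
  qed (rule s0)
  moreover have "bounded ((\<lambda>w. w e_last) ` A)"
    unfolding bounded_iff
  proof (intro exI ballI)
    fix y assume "y \<in> (\<lambda>w. w e_last) ` A"
    then obtain w where w: "w \<in> W" "snd (w e_last) \<le> M" "y = w e_last" by (auto simp: A_def)
    have y: "snd y > 0" "lorq y = -1"
      using w snd_W_pos[OF w(1), of e_last] by (simp_all add: lorq_W lorq_e_last)
    have "norm (fst y) \<le> snd y"
      using y by (intro norm_fst_le_snd) simp_all
    then show "norm y \<le> M + M"
      using norm_Pair_le[of "fst y" "snd y"] y w by simp
  qed
  ultimately have "finite ((\<lambda>w. w e_last) ` A)"
    using uniform_discrete_finite_iff by blast
  then show ?thesis using finite_imageD[OF _ inj] by (simp add: A_def)
qed

text \<open>Heights on the two orbits are comparable: \<open>snd (w x0)\<close> is at least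
  \<open>1 - norm (fst x0)\<close> times \<open>snd (w e_last)\<close>, by Cauchy-Schwarz.\<close>

lemma finite_W_bounded_orbit:
  assumes "x0 \<in> proj_model"
  shows "finite {w \<in> W. snd (w x0) \<le> M}"
proof -
  have x0: "lorq x0 < 0" "snd x0 = 1" using assms by (simp_all add: proj_model_def H_aff_def)
  have n: "norm (fst x0) < 1"
    by (rule power2_less_imp_less) (use x0 in \<open>simp_all add: lorq_eq\<close>)
  have "snd (w e_last) \<le> M / (1 - norm (fst x0))" if w: "w \<in> W" "snd (w x0) \<le> M" for w
  proof -
    obtain w' where w': "w' \<in> W" "w \<circ> w' = id" "w' \<circ> w = id" using W_inverse[OF w(1)] .
    define y where "y = w' e_last"
    have y: "snd y > 0" "lorq y = -1"
      using w' snd_W_pos[OF w'(1), of e_last] by (simp_all add: y_def lorq_W lorq_e_last)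
    have yn: "norm (fst y) \<le> snd y"
      using y by (intro norm_fst_le_snd) simp_all
    have "lorB (w x0) e_last = lorB x0 y"
      using lorB_W[OF w'(1), of "w x0" e_last] w'(3) unfolding y_def by (metis comp_apply id_apply)
    then have "snd (w x0) = snd y - fst x0 \<bullet> fst y"
      using x0 by (simp add: lorB_commute[of _ e_last] lorB_e_last) (simp add: lorB_def)
    moreover have "fst x0 \<bullet> fst y \<le> norm (fst x0) * norm (fst y)" by (rule norm_cauchy_schwarz)
    moreover have "norm (fst x0) * norm (fst y) \<le> norm (fst x0) * snd y"
      using yn by (intro mult_left_mono) auto
    ultimately have "snd y * (1 - norm (fst x0)) \<le> M"
      using w(2) by (simp add: algebra_simps)
    then show ?thesis
      using n snd_inverse_eq[OF w(1) w'(1,3)] by (simp add: y_def field_simps)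
  qed
  then show ?thesis
    by (intro finite_subset[OF _ finite_W_bounded[of "M / (1 - norm (fst x0))"]]) auto
qed

section \<open>Reflections in arbitrary roots\<close>

lemma root_facts:
  assumes "\<beta> \<in> root_system \<Delta>"
  shows "lorB \<beta> \<beta> = 1" "lor_refl \<beta> \<in> W"
proof -
  obtain w \<alpha> where w: "w \<in> W" "\<alpha> \<in> \<Delta>" "\<beta> = w \<alpha>"
    using assms by (auto simp: root_system_def)
  show "lorB \<beta> \<beta> = 1" using w by (simp add: lorB_W lorB_simple_self)
  obtain w' where w': "w' \<in> W" "w \<circ> w' = id" "w' \<circ> w = id" using W_inverse[OF w(1)] .
  \<comment> \<open>The reflection in \<open>w \<alpha>\<close> is the conjugate by \<open>w\<close>
    of the reflection in \<alpha>.\<close>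
  have "lor_refl \<beta> = w \<circ> (lor_refl \<alpha> \<circ> w')"
  proof
    fix v
    have v: "w (w' v) = v" using w'(2) by (metis comp_apply id_apply)
    have "lorB \<beta> v = lorB \<alpha> (w' v)" using lorB_W[OF w(1), of \<alpha> "w' v"] v w(3) by simp
    then show "lor_refl \<beta> v = (w \<circ> (lor_refl \<alpha> \<circ> w')) v"
      using linear_W[OF w(1)] v w(3) by (simp add: lor_refl_def linear_diff linear_scale)
  qed
  then show "lor_refl \<beta> \<in> W" using w w' by (simp add: comp_in_W refl_in_W)
qed

lemma lor_refl_e_last: "lor_refl \<beta> e_last = e_last + (2 * snd \<beta>) *\<^sub>R \<beta>"
  by (simp add: lor_refl_def lorB_commute[of _ e_last] lorB_e_last)

text \<open>The displacement of the base point under the reflection in \<beta> is a multiple of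
  \<beta>, so the reflection determines the direction. A bound on \<open>snd \<beta>\<close> bounds
  the height of the image, leaving finitely many group elements.\<close>

lemma finite_root_directions:
  "finite (hat ` {\<beta> \<in> root_system \<Delta>. snd \<beta> \<noteq> 0 \<and> \<bar>snd \<beta>\<bar> \<le> M})"
proof (rule finite_subset)
  show "hat ` {\<beta> \<in> root_system \<Delta>. snd \<beta> \<noteq> 0 \<and> \<bar>snd \<beta>\<bar> \<le> M}
    \<subseteq> (\<lambda>w. hat (w e_last - e_last)) ` {w \<in> W. snd (w e_last) \<le> 1 + 2 * M\<^sup>2}"
  proof (rule image_subsetI)
    fix \<beta> assume "\<beta> \<in> {\<beta> \<in> root_system \<Delta>. snd \<beta> \<noteq> 0 \<and> \<bar>snd \<beta>\<bar> \<le> M}"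
    then have \<beta>: "\<beta> \<in> root_system \<Delta>" "snd \<beta> \<noteq> 0" "\<bar>snd \<beta>\<bar> \<le> M" by simp_all
    have "hat \<beta> = hat (lor_refl \<beta> e_last - e_last)"
      using \<beta>(2) by (simp add: lor_refl_e_last hat_def)
    moreover have "snd (lor_refl \<beta> e_last) \<le> 1 + 2 * M\<^sup>2"
      using power_mono[OF \<beta>(3), of 2] by (simp add: lor_refl_e_last power2_eq_square)
    ultimately show "hat \<beta> \<in> (\<lambda>w. hat (w e_last - e_last)) ` {w \<in> W. snd (w e_last) \<le> 1 + 2 * M\<^sup>2}"
      using root_facts(2)[OF \<beta>(1)] by blast
  qed
qed (use finite_W_bounded in blast)


section \<open>Comparison of the limit sets\<close>

lemma orbit_limit_points_eq: "orbit_limit_points \<Delta> x = {z. z islimpt (\<lambda>w. hat (w x)) ` W}"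
  unfolding orbit_limit_points_def by (simp add: Setcompr_eq_image)

lemma limit_roots_eq:
  "limit_roots \<Delta> = {z. z islimpt hat ` {\<beta> \<in> root_system \<Delta>. snd \<beta> \<noteq> 0}}"
proof -
  have "{hat \<beta> | \<beta>. \<beta> \<in> root_system \<Delta> \<and> snd \<beta> \<noteq> 0} = hat ` {\<beta> \<in> root_system \<Delta>. snd \<beta> \<noteq> 0}"
    by blast
  then show ?thesis unfolding limit_roots_def by simp
qed

text \<open>Along a sequence of group elements the product of the two moving points is the constant
  \<open>lorB y x\<close>, while both heights tend to infinity. Exchanging the points yields
  equality.\<close>

lemma orbit_limit_points_mono:
  assumes x: "x \<in> proj_model" and y: "y \<in> proj_model"
  shows "orbit_limit_points \<Delta> x \<subseteq> orbit_limit_points \<Delta> y"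
proof
  fix z assume "z \<in> orbit_limit_points \<Delta> x"
  then have "z islimpt (\<lambda>w. hat (w x)) ` W"
    by (simp add: orbit_limit_points_eq)
  then obtain a :: "nat \<Rightarrow> _" where a: "\<And>n. a n \<in> W" "(\<lambda>n. hat (a n x)) \<longlonglongrightarrow> z"
      "filterlim (\<lambda>n. snd (a n x)) at_top sequentially"
    by (rule islimpt_escaping_sequence[where h = "\<lambda>w. snd (w x)"])
      (use finite_W_bounded_orbit[OF x] in auto)
  have q: "lorq x < 0" "lorq y < 0" using x y by (simp_all add: proj_model_def)
  have "filterlim (\<lambda>n. snd (a n y)) at_top sequentially"
    unfolding filterlim_at_top
  proof
    fix M
    \<comment> \<open>Only finitely many elements keep \<open>y\<close> low; once the height over
      \<open>x\<close> exceeds its values on \<open>F\<close>, the sequence has left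
      \<open>F\<close>.\<close>
    define F where "F = {w \<in> W. snd (w y) \<le> M}"
    have "finite F" unfolding F_def by (rule finite_W_bounded_orbit[OF y])
    then have b: "snd (w x) < 1 + (\<Sum>w\<in>F. \<bar>snd (w x)\<bar>)" if "w \<in> F" for w
      using member_le_sum[of w F "\<lambda>w. \<bar>snd (w x)\<bar>"] that by fastforce
    have "\<forall>\<^sub>F n in sequentially. 1 + (\<Sum>w\<in>F. \<bar>snd (w x)\<bar>) \<le> snd (a n x)"
      using a(3) by (simp add: filterlim_at_top)
    then show "\<forall>\<^sub>F n in sequentially. M \<le> snd (a n y)"
    proof eventually_elim
      case (elim n)
      then have "a n \<notin> F" using b[of "a n"] by linarith
      then show ?case using a(1) by (simp add: F_def)
    qed
  qed
  note y_inf = this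
  have "filterlim (\<lambda>n. snd (a n y) * snd (a n x)) at_top sequentially"
    by (rule filterlim_at_top_mult_at_top[OF y_inf a(3)])
  then have "(\<lambda>n. lorB y x / (snd (a n y) * snd (a n x))) \<longlonglongrightarrow> 0"
    by (intro tendsto_divide_0[OF tendsto_const] filterlim_at_top_imp_at_infinity)
  then have "z islimpt (\<lambda>w. hat (w y)) ` W"
    using a q y_inf
    by (intro islimpt_hat_transfer[where u = "\<lambda>n. a n y" and v = "\<lambda>n. a n x"
          and C = "max \<bar>lorq x\<bar> \<bar>lorq y\<bar>"])
      (auto simp: lorq_W lorB_W intro: filterlim_abs_at_top)
  then show "z \<in> orbit_limit_points \<Delta> y"
    by (simp add: orbit_limit_points_eq)
qed

lemma e_last_in_proj_model: "e_last \<in> proj_model"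
  by (simp add: proj_model_def H_aff_def lorq_e_last)

text \<open>If \<open>\<beta>\<close> is large, then its reflection moves the base point close to the direction of \<open>\<beta>\<close>.\<close>
lemma limit_roots_subset_orbit_limit_points:
  "limit_roots \<Delta> \<subseteq> orbit_limit_points \<Delta> e_last"
proof
  fix z assume "z \<in> limit_roots \<Delta>"
  then have "z islimpt hat ` {\<beta> \<in> root_system \<Delta>. snd \<beta> \<noteq> 0}"
    by (simp add: limit_roots_eq)
  then obtain b :: "nat \<Rightarrow> _" where b: "\<And>n. b n \<in> {\<beta> \<in> root_system \<Delta>. snd \<beta> \<noteq> 0}"
      "(\<lambda>n. hat (b n)) \<longlonglongrightarrow> z" "filterlim (\<lambda>n. \<bar>snd (b n)\<bar>) at_top sequentially"
    by (rule islimpt_escaping_sequence[where h = "\<lambda>\<beta>. \<bar>snd \<beta>\<bar>"])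
      (use finite_root_directions in \<open>auto simp: conj_assoc\<close>)
  have r: "lorB (b n) (b n) = 1" "lor_refl (b n) \<in> W" "snd (b n) \<noteq> 0" for n
    using b(1) root_facts by auto
  define u where "u n = lor_refl (b n) e_last" for n
  have su: "snd (u n) = 1 + 2 * \<bar>snd (b n)\<bar>\<^sup>2" for n
    by (simp add: u_def lor_refl_e_last power2_eq_square)
  have sq: "filterlim (\<lambda>n. 1 + 2 * \<bar>snd (b n)\<bar>\<^sup>2) at_top sequentially"
    by (intro filterlim_tendsto_add_at_top[OF tendsto_const]
        filterlim_tendsto_pos_mult_at_top[OF tendsto_const] filterlim_pow_at_top b(3)) auto
  \<comment> \<open>The reflection negates \<open>b n\<close>, so the product is minus that of
    \<open>e_last\<close> with \<open>b n\<close>; the quotient to be controlled becomes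
    \<open>1 / snd (u n)\<close>.\<close>
  have B: "lorB (u n) (b n) = snd (b n)" for n
    using r(1)[of n] by (simp add: u_def lor_refl_e_last lorB_e_last)
  have "(\<lambda>n. 1 / (1 + 2 * \<bar>snd (b n)\<bar>\<^sup>2)) \<longlonglongrightarrow> 0"
    by (intro tendsto_divide_0[OF tendsto_const] filterlim_at_top_imp_at_infinity sq)
  then have lim: "(\<lambda>n. lorB (u n) (b n) / (snd (u n) * snd (b n))) \<longlonglongrightarrow> 0"
    by (simp add: B su r(3))
  have "z islimpt (\<lambda>w. hat (w e_last)) ` W"
  proof (rule islimpt_hat_transfer[where u = u and v = b and C = 1, OF b(2) _ _ _ b(3) lim])
    show "filterlim (\<lambda>n. \<bar>snd (u n)\<bar>) at_top sequentially"
      unfolding su using sq by (rule filterlim_abs_at_top)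
  qed (use r in \<open>auto simp: u_def lorq_W lorq_e_last lorq_def[of "b _"]\<close>)
  then show "z \<in> orbit_limit_points \<Delta> e_last"
    by (simp add: orbit_limit_points_eq)
qed

text \<open>As \<open>\<Delta>\<close> spans, whenever \<open>w e_last\<close> is large so is \<open>w \<alpha>\<close> for some simple root \<open>\<alpha>\<close>, while the
  product of these two vectors stays bounded.\<close>
lemma orbit_limit_points_subset_limit_roots:
  assumes "span \<Delta> = UNIV"
  shows "orbit_limit_points \<Delta> e_last \<subseteq> limit_roots \<Delta>"
proof
  fix z assume "z \<in> orbit_limit_points \<Delta> e_last"
  then have "z islimpt (\<lambda>w. hat (w e_last)) ` W"
    by (simp add: orbit_limit_points_eq)
  then obtain a :: "nat \<Rightarrow> _" where a: "\<And>n. a n \<in> W" "(\<lambda>n. hat (a n e_last)) \<longlonglongrightarrow> z"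
      "filterlim (\<lambda>n. snd (a n e_last)) at_top sequentially"
    by (rule islimpt_escaping_sequence[where h = "\<lambda>w. snd (w e_last)"])
      (use finite_W_bounded in auto)
  obtain c where c: "e_last = (\<Sum>\<alpha>\<in>\<Delta>. c \<alpha> *\<^sub>R \<alpha>)"
    using assms span_finite[OF finite_simple] by (smt (verit) UNIV_I imageE)
  \<comment> \<open>The added 1 makes \<open>C\<close> positive and strictly larger than the sum of
    the absolute coefficients, even if that sum vanishes; the strictness gives the contradiction
    below.\<close>
  define C where "C = 1 + (\<Sum>\<alpha>\<in>\<Delta>. \<bar>c \<alpha>\<bar>)"
  have C: "C > 0" by (simp add: C_def add_pos_nonneg sum_nonneg)
  have "\<exists>\<alpha>\<in>\<Delta>. snd (w e_last) / C \<le> \<bar>snd (w \<alpha>)\<bar>" if w: "w \<in> W" for w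
  proof (rule ccontr)
    assume n: "\<not> ?thesis"
    have p: "snd (w e_last) > 0" using w by (simp add: snd_W_pos lorq_e_last)
    have "snd (w e_last) = (\<Sum>\<alpha>\<in>\<Delta>. c \<alpha> * snd (w \<alpha>))"
      using linear_W[OF w] by (subst c) (simp add: linear_sum linear_scale snd_sum)
    also have "\<dots> \<le> (\<Sum>\<alpha>\<in>\<Delta>. \<bar>c \<alpha>\<bar> * \<bar>snd (w \<alpha>)\<bar>)"
      by (intro sum_mono) (metis abs_ge_self abs_mult)
    also have "\<dots> \<le> (\<Sum>\<alpha>\<in>\<Delta>. \<bar>c \<alpha>\<bar> * (snd (w e_last) / C))"
      using n by (intro sum_mono mult_left_mono) auto
    also have "\<dots> = (\<Sum>\<alpha>\<in>\<Delta>. \<bar>c \<alpha>\<bar>) * (snd (w e_last) / C)"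
      by (rule sum_distrib_right[symmetric])
    also have "\<dots> < C * (snd (w e_last) / C)"
      using p C by (intro mult_strict_right_mono) (simp_all add: C_def)
    finally show False using C by simp
  qed
  then have "\<forall>n. \<exists>\<alpha>. \<alpha> \<in> \<Delta> \<and> snd (a n e_last) / C \<le> \<bar>snd (a n \<alpha>)\<bar>"
    using a(1) by blast
  then obtain r where r: "\<And>n. r n \<in> \<Delta>" "\<And>n. snd (a n e_last) / C \<le> \<bar>snd (a n (r n))\<bar>"
    by metis
  define u where "u n = a n (r n)" for n
  have "filterlim (\<lambda>n. snd (a n e_last) / C) at_top sequentially"
    using filterlim_tendsto_pos_mult_at_top[OF tendsto_const _ a(3), of "1 / C"] C by simp
  then have su: "filterlim (\<lambda>n. \<bar>snd (u n)\<bar>) at_top sequentially"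
    by (rule filterlim_at_top_mono) (simp add: u_def r(2))
  have sa: "filterlim (\<lambda>n. \<bar>snd (a n e_last)\<bar>) at_top sequentially"
    using a(3) by (rule filterlim_abs_at_top)
  define K where "K = (\<Sum>\<alpha>\<in>\<Delta>. \<bar>snd \<alpha>\<bar>)"
  have K: "\<bar>lorB (u n) (a n e_last)\<bar> \<le> K" for n
  proof -
    have "\<bar>lorB (u n) (a n e_last)\<bar> = \<bar>snd (r n)\<bar>"
      using a(1) by (simp add: u_def lorB_W lorB_commute[of _ e_last] lorB_e_last)
    also have "\<dots> \<le> K" unfolding K_def
      using r(1) finite_simple by (intro member_le_sum) auto
    finally show ?thesis .
  qed
  have "filterlim (\<lambda>n. \<bar>snd (u n)\<bar> * \<bar>snd (a n e_last)\<bar>) at_top sequentially"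
    by (rule filterlim_at_top_mult_at_top[OF su sa])
  then have "(\<lambda>n. K / (\<bar>snd (u n)\<bar> * \<bar>snd (a n e_last)\<bar>)) \<longlonglongrightarrow> 0"
    by (intro tendsto_divide_0[OF tendsto_const] filterlim_at_top_imp_at_infinity)
  then have lim: "(\<lambda>n. lorB (u n) (a n e_last) / (snd (u n) * snd (a n e_last))) \<longlonglongrightarrow> 0"
    by (rule Lim_null_comparison[rotated]) (use K in \<open>simp add: abs_mult divide_right_mono\<close>)
  have "z islimpt hat ` {\<beta> \<in> root_system \<Delta>. snd \<beta> \<noteq> 0}"
  proof (rule islimpt_hat_transfer[where u = u and v = "\<lambda>n. a n e_last" and C = 1, OF a(2) _ _ su sa lim])
    \<comment> \<open>A root has a direction in the affine hyperplane only if its last coordinate is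
      nonzero; growth guarantees this eventually.\<close>
    have "\<forall>\<^sub>F n in sequentially. \<bar>snd (u n)\<bar> \<ge> 1" using su by (simp add: filterlim_at_top)
    then show "\<forall>\<^sub>F n in sequentially. hat (u n) \<in> hat ` {\<beta> \<in> root_system \<Delta>. snd \<beta> \<noteq> 0}"
    proof eventually_elim
      case (elim n)
      have "u n \<in> root_system \<Delta>"
        using a(1) r(1) unfolding u_def root_system_def by blast
      then show ?case using elim by auto
    qed
  qed (use a(1) r(1) in \<open>simp_all add: u_def lorq_W lorq_e_last\<close>, simp_all add: lorq_def lorB_simple_self)
  then show "z \<in> limit_roots \<Delta>"
    by (simp add: limit_roots_eq)
qed

end

theorem theorem3p3:
  fixes \<Delta> :: "('a::euclidean_space \<times> real) set" and x0 :: "'a \<times> real"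
  assumes "simple_system \<Delta>"
    and "span \<Delta> = UNIV"
    and "\<forall>\<beta>\<in>positive_roots \<Delta>. snd \<beta> \<noteq> 0"
    and "\<forall>\<alpha>\<in>\<Delta>. lorB e_last \<alpha> < 0"
    and "x0 \<in> proj_model"
  shows "orbit_limit_points \<Delta> x0 = limit_roots \<Delta>"
proof -
  interpret future_simple_system \<Delta>
    using assms(1,4) by unfold_locales (auto simp: lorB_e_last)
  have "orbit_limit_points \<Delta> x0 = orbit_limit_points \<Delta> e_last"
    using orbit_limit_points_mono assms(5) e_last_in_proj_model by blast
  also have "\<dots> = limit_roots \<Delta>"
    using limit_roots_subset_orbit_limit_points orbit_limit_points_subset_limit_roots[OF assms(2)] by blast
  finally show ?thesis .
qed

end
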